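(* Let $G$ be a $1$-dimensional finite abstract simplicial complex with connection Laplacian $L$. Then the spectrum of $L^2$ satisfies $\sigma(L^2)=\sigma(L^{-2})$, where $\sigma$ denotes the spectrum counted with multiplicity.
   Context: A finite abstract simplicial complex $G$ is a finite set of non-empty finite sets (simplices) closed under taking non-empty subsets; it is $1$-dimensional if every $x\in G$ has $|x|\le2$ and at least one $x\in G$ has $|x|=2$. The connection Laplacian $L$ is the $|G|\times|G|$ matrix indexed by $G$ with $L(x,y)=1$ if $x\cap y\ne\emptyset$ and $0$ otherwise; it is known that $|\det L|=1$, so $L$ is invertible. *)

theory Defs
  imports
    "Jordan_Normal_Form.Char_Poly"
    "Jordan_Normal_Form.Gauss_Jordan_Elimination"
    "HOL-Computational_Algebra.Polynomial"
begin

definition simplicial_complex :: "'a set set \<Rightarrow> bool" where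
  "simplicial_complex G \<longleftrightarrow>
     finite G \<and> (\<forall>x\<in>G. finite x \<and> x \<noteq> {}) \<and>
     (\<forall>x\<in>G. \<forall>y. y \<subseteq> x \<and> y \<noteq> {} \<longrightarrow> y \<in> G)"

definition one_dimensional :: "'a set set \<Rightarrow> bool" where
  "one_dimensional G \<longleftrightarrow> (\<forall>x\<in>G. card x \<le> 2) \<and> (\<exists>x\<in>G. card x = 2)"

text \<open>Matrices are indexed by an initial segment of the naturals, so a matrix indexed by
  the simplices is taken with respect to a repetition-free list \<open>xs\<close> of them.\<close>

definition connection_laplacian :: "'a set list \<Rightarrow> complex mat" where
  "connection_laplacian xs =
     mat (length xs) (length xs) (\<lambda>(i, j). if xs ! i \<inter> xs ! j \<noteq> {} then 1 else 0)"

definition mat_inv :: "'a :: field mat \<Rightarrow> 'a mat" where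
  "mat_inv A = the (mat_inverse A)"

text \<open>The eigenvalues, each repeated according to its algebraic multiplicity.\<close>

definition spectrum_mset :: "complex mat \<Rightarrow> complex multiset" where
  "spectrum_mset A = proots (char_poly A)"

lemma mat_inv:
  fixes A :: "'a :: field mat"
  assumes A: "A \<in> carrier_mat n n" and det: "det A \<noteq> 0"
  shows "mat_inv A \<in> carrier_mat n n" "A * mat_inv A = 1\<^sub>m n" "mat_inv A * A = 1\<^sub>m n"
proof -
  obtain B where B: "mat_inverse A = Some B"
    using mat_inverse(1)[OF A, of "()"] det_non_zero_imp_unit[OF A det, of "()"]
    by (cases "mat_inverse A") auto
  show "mat_inv A \<in> carrier_mat n n" "A * mat_inv A = 1\<^sub>m n" "mat_inv A * A = 1\<^sub>m n"
    using mat_inverse(2)[OF A B] B by (auto simp: mat_inv_def)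
qed

text \<open>On the complexes of interest \<^const>\<open>mat_inv\<close> therefore returns a genuine inverse:\<close>

lemma det_connection_laplacian_nonzero:
  assumes G: "simplicial_complex G" "one_dimensional G"
    and xs: "distinct xs" "set xs = G"
  shows "det (connection_laplacian xs) \<noteq> 0"
proof
  let ?n = "length xs" and ?L = "connection_laplacian xs"
  have L: "?L \<in> carrier_mat ?n ?n" by (simp add: connection_laplacian_def)
  assume "det ?L = 0"
  then obtain v where v: "v \<in> carrier_vec ?n" "v \<noteq> 0\<^sub>v ?n" "?L *\<^sub>v v = 0\<^sub>v ?n"
    using det_0_iff_vec_prod_zero[OF L] by auto
  have fin: "finite G" using G(1) by (simp add: simplicial_complex_def)
  have simplex: "finite y" "y \<noteq> {}" "card y \<le> 2" if "y \<in> G" for y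
    using G that unfolding simplicial_complex_def one_dimensional_def by blast+
  have bij: "bij_betw ((!) xs) {..<?n} G"
    using bij_betw_nth[OF xs(1), of "{..<?n}" G] xs(2) by auto
  define w where "w y = v $ (the_inv_into {..<?n} ((!) xs) y)" for y
  have w: "w (xs ! j) = v $ j" if "j < ?n" for j
    using the_inv_into_f_f[OF bij_betw_imp_inj_on[OF bij], of j] that by (simp add: w_def)
  have eq: "(\<Sum>y | y \<in> G \<and> x \<inter> y \<noteq> {}. w y) = 0" if "x \<in> G" for x
  proof -
    from that xs(2) obtain i where i: "i < ?n" "x = xs ! i"
      by (metis in_set_conv_nth)
    have "0 = (?L *\<^sub>v v) $ i" using v(3) i by simp
    also have "\<dots> = (\<Sum>j<?n. (if x \<inter> xs ! j \<noteq> {} then 1 else 0) * w (xs ! j))"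
      using i v(1) w unfolding connection_laplacian_def
      by (auto simp: scalar_prod_def lessThan_atLeast0 intro!: sum.cong)
    also have "\<dots> = (\<Sum>y\<in>G. (if x \<inter> y \<noteq> {} then 1 else 0) * w y)"
      by (rule sum.reindex_bij_betw[OF bij])
    also have "\<dots> = (\<Sum>y\<in>G. if x \<inter> y \<noteq> {} then w y else 0)"
      by (rule sum.cong) auto
    also have "\<dots> = (\<Sum>y | y \<in> G \<and> x \<inter> y \<noteq> {}. w y)"
      using fin by (simp add: sum.inter_filter)
    finally show ?thesis by simp
  qed
  define S where "S a = {y \<in> G. a \<in> y}" for a
  have finS: "finite (S a)" for a using fin by (simp add: S_def)
  have S0: "sum w (S a) = 0" if "{a} \<in> G" for a
    using eq[OF that] by (simp add: S_def)
  have face: "{a} \<in> G" if "x \<in> G" "a \<in> x" for a x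
    using that G(1) unfolding simplicial_complex_def
    by (metis empty_subsetI insert_not_empty insert_subset)
  have edge: "w {a, b} = 0" if e: "{a, b} \<in> G" "a \<noteq> b" for a b
  proof -
    have "y = {a, b}" if "y \<in> G" "a \<in> y" "b \<in> y" for y
    proof -
      have "{a, b} = y"
        by (rule card_seteq) (use simplex[OF that(1)] that e(2) in simp_all)
      then show ?thesis by simp
    qed
    then have int: "S a \<inter> S b = {{a, b}}" using e unfolding S_def by blast
    have un: "{y \<in> G. {a, b} \<inter> y \<noteq> {}} = S a \<union> S b" by (auto simp: S_def)
    have "sum w (S a \<union> S b) = 0" using eq[OF e(1)] un by simp
    moreover have "sum w (S a \<union> S b) + sum w (S a \<inter> S b) = sum w (S a) + sum w (S b)"
      by (rule sum.union_inter[OF finS finS])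
    ultimately show ?thesis using S0 face[OF e(1)] int by simp
  qed
  have two: "w y = 0" if "y \<in> G" "card y = 2" for y
    using edge that by (auto simp: card_2_iff)
  have one: "w {a} = 0" if a: "{a} \<in> G" for a
  proof -
    have "w y = 0" if y: "y \<in> S a - {{a}}" for y
    proof -
      have yG: "y \<in> G" "a \<in> y" "y \<noteq> {a}" using y by (auto simp: S_def)
      then have "card y \<noteq> 0" using simplex[of y] by simp
      moreover have "card y \<noteq> 1" using yG by (auto simp: card_1_singleton_iff)
      ultimately have "card y = 2" using simplex(3)[OF yG(1)] by linarith
      with yG(1) show ?thesis by (rule two)
    qed
    then have "sum w (S a - {{a}}) = 0" by (rule sum.neutral[rule_format])
    moreover have "sum w (S a) = w {a} + sum w (S a - {{a}})"
      using a by (intro sum.remove[OF finS]) (auto simp: S_def)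
    ultimately show ?thesis using S0[OF a] by simp
  qed
  have "w y = 0" if y: "y \<in> G" for y
  proof -
    have "card y \<noteq> 0" using simplex[OF y] by simp
    then have "card y = 1 \<or> card y = 2" using simplex(3)[OF y] by linarith
    then show ?thesis using one two y by (auto simp: card_1_singleton_iff)
  qed
  then have "v $ j = 0" if "j < ?n" for j
    using w[OF that] nth_mem[OF that] xs(2) by simp
  then have "v = 0\<^sub>v ?n" using v(1) by auto
  with v(2) show False by simp
qed

end

theory Submission
  imports Defs
begin

text \<open>Let \<open>N\<close> be the vertex-edge incidence matrix of \<open>G\<close>, extended by zero to a square matrix
  indexed by all simplices, let \<open>M = N\<^sup>T\<close>, and let \<open>J\<close> be the diagonal matrix with entry \<open>1\<close> at
  vertices and \<open>-1\<close> at edges. Two edges meet in \<open>(M N)(e, f)\<close> vertices, and from this one reads off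
  \<open>L = J + N + M + M N = (1 + M) J (1 + N)\<close> (lemma \<open>connection_laplacian_decomposition\<close>).
  Since \<open>N\<close> and \<open>M\<close> square to zero, \<open>L\<close> has the inverse \<open>(1 - N) J (1 - M) = J + N + M - N M\<close>.

  The two squares are compared through the antisymmetric matrix \<open>S = N - M\<close>. On the one hand
  \<open>L - L\<inverse> = M N + N M = - S\<^sup>2\<close>, a signless Hodge Laplacian; on the other hand \<open>L S L = - S\<close>,
  so that \<open>S\<close> carries an eigenvector of \<open>L\<close> for \<open>\<lambda>\<close> to one for \<open>- 1 / \<lambda>\<close>, or to zero. This matches
  eigenvalues \<open>\<lambda>\<^sup>2\<close> and \<open>1 / \<lambda>\<^sup>2\<close>, but \<open>S\<close> may be singular, so it does not by itself account for
  multiplicities. The two identities, however, combine to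
  \<open>L\<^sup>2 = 1 - S (S L)\<close> and \<open>L\<inverse>\<^sup>2 = 1 - (S L) S\<close> (lemma \<open>incidence_algebra\<close>).
  The products \<open>S (S L)\<close> and \<open>(S L) S\<close> of the same two square matrices have the same characteristic
  polynomial, whether or not the factors are invertible, and hence so do \<open>L\<^sup>2\<close> and \<open>L\<inverse>\<^sup>2\<close>
  (lemma \<open>char_poly_one_minus_mult_commute\<close>).\<close>

section \<open>Exchanging the factors of a product\<close>

text \<open>A block matrix whose two lower blocks commute has as determinant that of its formal
  \<open>2 \<times> 2\<close> determinant. This applies to the matrix with diagonal blocks \<open>a\<close>, \<open>1\<close> and off-diagonal
  blocks \<open>X\<close>, \<open>Y\<close>, and again after conjugation with the permutation matrix \<open>W\<close> that exchanges the
  two halves; since \<open>a\<close> is a scalar, the lower blocks commute in both arrangements.\<close>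

lemma det_smult_one_minus_mult_commute:
  fixes X Y :: "'a :: idom mat"
  assumes X: "X \<in> carrier_mat n n" and Y: "Y \<in> carrier_mat n n"
  shows "det (a \<cdot>\<^sub>m 1\<^sub>m n - X * Y) = det (a \<cdot>\<^sub>m 1\<^sub>m n - Y * X)"
proof -
  let ?I = "1\<^sub>m n :: 'a mat" and ?Z = "0\<^sub>m n n :: 'a mat"
  let ?A = "a \<cdot>\<^sub>m ?I"
  let ?M = "four_block_mat ?A X Y ?I" and ?M' = "four_block_mat ?I Y X ?A"
  let ?W = "four_block_mat ?Z ?I ?I ?Z"
  have I: "?I \<in> carrier_mat n n" and Z: "?Z \<in> carrier_mat n n" and A: "?A \<in> carrier_mat n n"
    by auto
  have WW: "?W * ?W = 1\<^sub>m (n + n)"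
    by (subst mult_four_block_mat[OF Z I I Z Z I I Z]) simp
  have WM: "?W * ?M = ?M' * ?W"
    using X Y by (simp add: mult_four_block_mat[OF Z I I Z A X Y I]
        mult_four_block_mat[OF I Y X A Z I I Z])
  have carr: "?W \<in> carrier_mat (n + n) (n + n)" "?M \<in> carrier_mat (n + n) (n + n)"
    "?M' \<in> carrier_mat (n + n) (n + n)"
    using X Y by auto
  have "det ?W * det ?W = 1"
    using arg_cong[OF WW, of det] carr by (simp add: det_mult[of _ "n + n"])
  then have W0: "det ?W \<noteq> 0" by auto
  have "det ?W * det ?M = det ?W * det ?M'"
    using arg_cong[OF WM, of det] det_mult[OF carr(1,2)] det_mult[OF carr(3,1)] by simp
  with W0 have "det ?M = det ?M'" by simp
  also have "det ?M = det (?A - X * Y)"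
    using X Y by (subst det_four_block_mat[OF A X Y I]) auto
  also have "det ?M' = det (?A - Y * X)"
    using X Y by (subst det_four_block_mat[OF I Y X A]) auto
  finally show ?thesis .
qed

text \<open>At a point \<open>k\<close>, both sides are determinants of the shape just treated with \<open>a = k - 1\<close>, the
  sign of the product being absorbed into \<open>X\<close>.\<close>

lemma char_poly_one_minus_mult_commute:
  fixes X Y :: "'a :: field_char_0 mat"
  assumes X: "X \<in> carrier_mat n n" and Y: "Y \<in> carrier_mat n n"
  shows "char_poly (1\<^sub>m n - X * Y) = char_poly (1\<^sub>m n - Y * X)"
proof -
  have poly: "poly (char_poly (1\<^sub>m n - A * B)) k = det ((k - 1) \<cdot>\<^sub>m 1\<^sub>m n - (- A) * B)"
    if A: "A \<in> carrier_mat n n" and B: "B \<in> carrier_mat n n" for A B :: "'a mat" and k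
  proof -
    have "1\<^sub>m n - A * B \<in> carrier_mat n n" using A B by auto
    moreover have "- char_matrix (1\<^sub>m n - A * B) k = (k - 1) \<cdot>\<^sub>m 1\<^sub>m n - (- A) * B"
      using A B by (intro eq_matI) (auto simp: char_matrix_def)
    ultimately show ?thesis by (simp add: char_poly_matrix)
  qed
  have swap: "(- Y) * X = Y * (- X)" using X Y by auto
  show ?thesis
    using X Y det_smult_one_minus_mult_commute[of "- X" n Y]
    by (intro poly_ext) (simp add: poly swap)
qed

section \<open>The algebra of incidence and dimension\<close>

text \<open>The hypotheses say that \<open>J\<close> is a grading with eigenvalues \<open>1\<close> and \<open>-1\<close>, that \<open>N\<close> maps
  the \<open>-1\<close> part to the \<open>1\<close> part, and that \<open>M\<close> maps it back. They reduce every word in the three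
  letters, up to sign, to \<open>1\<close>, \<open>J\<close>, zero, or an alternating word in \<open>M\<close> and \<open>N\<close>. Each of the three
  claims becomes true on expanding it into such normal forms.\<close>

lemma incidence_algebra:
  fixes J M N :: "'a :: comm_ring_1 mat"
  assumes carr: "J \<in> carrier_mat n n" "M \<in> carrier_mat n n" "N \<in> carrier_mat n n"
    and J: "J * J = 1\<^sub>m n" "J * N = N" "N * J = - N" "J * M = - M" "M * J = M"
    and nil: "N * N = 0\<^sub>m n n" "M * M = 0\<^sub>m n n"
  defines "L \<equiv> J + N + M + M * N" and "K \<equiv> J + N + M - N * M" and "S \<equiv> N - M"
  shows "L * K = 1\<^sub>m n" "L * L = 1\<^sub>m n - S * (S * L)" "K * K = 1\<^sub>m n - (S * L) * S"
proof -
  have c: "x * y \<in> carrier_mat n n" "x + y \<in> carrier_mat n n" "x - y \<in> carrier_mat n n"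
     "- x \<in> carrier_mat n n"
    if "x \<in> carrier_mat n n" "y \<in> carrier_mat n n" for x y :: "'a mat"
    using that by auto
  have word: "J * (J * x) = x" "J * (N * x) = N * x" "N * (J * x) = - (N * x)"
    "J * (M * x) = - (M * x)" "M * (J * x) = M * x" "N * (N * x) = 0\<^sub>m n n" "M * (M * x) = 0\<^sub>m n n"
    if x: "x \<in> carrier_mat n n" for x
    using J nil carr x by (simp_all flip: assoc_mult_mat[of _ n n _ n x n])
  note expand = assoc_mult_mat[of _ n n _ n _ n] add_mult_distrib_mat[of _ n n _ _ n]
    mult_add_distrib_mat[of _ n n _ n] minus_mult_distrib_mat[of _ n n _ _ n]
    mult_minus_distrib_mat[of _ n n _ n] carr J nil c word
    carrier_matD[OF carr(1)] carrier_matD[OF carr(2)] carrier_matD[OF carr(3)]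
    left_mult_zero_mat[of _ n n] right_mult_zero_mat[of _ n n]
  show "L * K = 1\<^sub>m n" "L * L = 1\<^sub>m n - S * (S * L)" "K * K = 1\<^sub>m n - (S * L) * S"
    unfolding L_def K_def S_def
    (* Once the products are expanded, only additive bookkeeping is left, which is done entrywise
       with the alternating words kept as opaque products. *)
    by (simp_all add: expand del: index_mult_mat,
        (intro eq_matI; use carr in \<open>simp del: index_mult_mat(1)\<close>)+)
qed

section \<open>The matrices of a one-dimensional complex\<close>

definition dim_sign :: "'a set \<Rightarrow> complex" where
  "dim_sign x = (if card x = 1 then 1 else - 1)"

definition incidence :: "'a set \<Rightarrow> 'a set \<Rightarrow> complex" where
  "incidence x y = of_bool (card x = 1 \<and> card y = 2 \<and> x \<subseteq> y)"

definition dim_sign_mat :: "'a set list \<Rightarrow> complex mat" where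
  "dim_sign_mat xs = mat_diag (length xs) (\<lambda>i. dim_sign (xs ! i))"

definition incidence_mat :: "'a set list \<Rightarrow> complex mat" where
  "incidence_mat xs = mat (length xs) (length xs) (\<lambda>(i, j). incidence (xs ! i) (xs ! j))"

lemma incidence_carrier [simp]:
  "connection_laplacian xs \<in> carrier_mat (length xs) (length xs)"
  "dim_sign_mat xs \<in> carrier_mat (length xs) (length xs)"
  "incidence_mat xs \<in> carrier_mat (length xs) (length xs)"
  "transpose_mat (incidence_mat xs) \<in> carrier_mat (length xs) (length xs)"
  by (simp_all add: connection_laplacian_def dim_sign_mat_def incidence_mat_def)

lemma incidence_relations:
  fixes xs :: "'a set list"
  defines "n \<equiv> length xs" and "J \<equiv> dim_sign_mat xs" and "N \<equiv> incidence_mat xs"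
    and "M \<equiv> transpose_mat (incidence_mat xs)"
  shows "J * J = 1\<^sub>m n" "J * N = N" "N * J = - N" "J * M = - M" "M * J = M"
    and "N * N = 0\<^sub>m n n" "M * M = 0\<^sub>m n n"
proof -
  have carr: "J \<in> carrier_mat n n" "M \<in> carrier_mat n n" "N \<in> carrier_mat n n"
    by (simp_all add: J_def M_def N_def n_def)
  show "J * J = 1\<^sub>m n" "J * N = N" "N * J = - N" "J * M = - M" "M * J = M"
    using carr unfolding J_def dim_sign_mat_def n_def
    by (simp_all add: mat_diag_mult_left[of _ "length xs" "length xs"]
          mat_diag_mult_right[of _ "length xs" "length xs"];
        auto intro!: eq_matI simp: N_def M_def incidence_mat_def dim_sign_def incidence_def
          mat_diag_def)+
  show "N * N = 0\<^sub>m n n" "M * M = 0\<^sub>m n n"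
    by (auto intro!: eq_matI sum.neutral
        simp: N_def M_def n_def incidence_mat_def scalar_prod_def incidence_def)
qed

lemma simplex_of_one_dimensional_complex:
  assumes "simplicial_complex G" "one_dimensional G" "x \<in> G"
  shows "finite x" "x \<noteq> {}" "card x = 1 \<or> card x = 2"
proof -
  show fin: "finite x" "x \<noteq> {}"
    using assms(1,3) by (auto simp: simplicial_complex_def)
  then have "card x \<noteq> 0" "card x \<le> 2"
    using assms(2,3) by (auto simp: one_dimensional_def)
  then show "card x = 1 \<or> card x = 2" by linarith
qed

text \<open>The sum over simplices that defines the entry counts the vertices common to the two edges; that
  every point of an edge is such a vertex is where closure under subsets enters.\<close>

lemma incidence_gram_entry:
  fixes xs :: "'a set list"
  assumes G: "simplicial_complex G" and xs: "distinct xs" "set xs = G"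
    and ij: "i < length xs" "j < length xs" and edges: "card (xs ! i) = 2" "card (xs ! j) = 2"
  shows "(transpose_mat (incidence_mat xs) * incidence_mat xs) $$ (i, j) =
    of_nat (card (xs ! i \<inter> xs ! j))" (is "?P $$ (i, j) = _")
proof -
  let ?x = "xs ! i" and ?y = "xs ! j"
  have bij: "bij_betw ((!) xs) {..<length xs} G"
    using bij_betw_nth[OF xs(1), of "{..<length xs}" G] xs(2) by auto
  have fin: "finite G" using G by (simp add: simplicial_complex_def)
  have "?P $$ (i, j) = (\<Sum>k<length xs. incidence (xs ! k) ?x * incidence (xs ! k) ?y)"
    using ij by (simp add: incidence_mat_def scalar_prod_def lessThan_atLeast0)
  also have "\<dots> = (\<Sum>z\<in>G. incidence z ?x * incidence z ?y)"
    by (rule sum.reindex_bij_betw[OF bij])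
  also have "\<dots> = (\<Sum>z\<in>G. if card z = 1 \<and> z \<subseteq> ?x \<inter> ?y then 1 else 0)"
    using edges by (intro sum.cong) (auto simp: incidence_def)
  also have "\<dots> = of_nat (card {z \<in> G. card z = 1 \<and> z \<subseteq> ?x \<inter> ?y})"
    using fin by (simp flip: sum.inter_filter)
  also have "{z \<in> G. card z = 1 \<and> z \<subseteq> ?x \<inter> ?y} = (\<lambda>a. {a}) ` (?x \<inter> ?y)"
  proof -
    have "?x \<in> G" using ij xs(2) by auto
    then have "{a} \<in> G" if "a \<in> ?x" for a
      using G that unfolding simplicial_complex_def by blast
    then show ?thesis by (auto simp: card_1_singleton_iff)
  qed
  also have "card \<dots> = card (?x \<inter> ?y)" by (rule card_image) auto
  finally show ?thesis .
qed

text \<open>The only entries that are not immediate are those at two edges. Distinct edges share at most one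
  vertex, so there the number of common vertices is the entry of \<open>L\<close>; an edge shares two
  vertices with itself, and the \<open>-1\<close> in \<open>J\<close> corrects the diagonal.\<close>

lemma connection_laplacian_decomposition:
  fixes xs :: "'a set list"
  assumes G: "simplicial_complex G" "one_dimensional G" and xs: "distinct xs" "set xs = G"
  defines "J \<equiv> dim_sign_mat xs" and "N \<equiv> incidence_mat xs"
    and "M \<equiv> transpose_mat (incidence_mat xs)"
  shows "connection_laplacian xs = J + N + M + M * N"
proof (rule eq_matI)
  fix i j assume "i < dim_row (J + N + M + M * N)" "j < dim_col (J + N + M + M * N)"
  then have ij: "i < length xs" "j < length xs"
    by (simp_all add: M_def N_def incidence_mat_def)
  let ?L = "connection_laplacian xs" and ?x = "xs ! i" and ?y = "xs ! j"
  have eq: "i = j \<longleftrightarrow> ?x = ?y" using ij xs(1) by (simp add: nth_eq_iff_index_eq)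
  have "?x \<in> G" "?y \<in> G" using ij xs(2) by auto
  note x = simplex_of_one_dimensional_complex[OF G \<open>?x \<in> G\<close>]
    and y = simplex_of_one_dimensional_complex[OF G \<open>?y \<in> G\<close>]
  have lhs: "?L $$ (i, j) = of_bool (?x \<inter> ?y \<noteq> {})"
    using ij by (simp add: connection_laplacian_def)
  have rhs: "(J + N + M + M * N) $$ (i, j) =
      (if ?x = ?y then dim_sign ?x else 0) + incidence ?x ?y + incidence ?y ?x + (M * N) $$ (i, j)"
    using ij eq by (simp add: J_def N_def M_def dim_sign_mat_def incidence_mat_def mat_diag_def
        del: index_mult_mat(1))
  have MN0: "(M * N) $$ (i, j) = 0" if "card ?x = 1 \<or> card ?y = 1"
    using ij that
    by (auto intro!: sum.neutral simp: M_def N_def incidence_mat_def scalar_prod_def incidence_def)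
  show "?L $$ (i, j) = (J + N + M + M * N) $$ (i, j)"
  proof (cases "card ?x = 1 \<or> card ?y = 1")
    case True
    then consider (vertices) a b where "?x = {a}" "?y = {b}"
      | (vertex_edge) a where "?x = {a}" "card ?y = 2"
      | (edge_vertex) b where "card ?x = 2" "?y = {b}"
      using x y by (auto simp: card_1_singleton_iff)
    then show ?thesis
    proof cases
      case vertices
      then show ?thesis by (simp add: lhs rhs MN0 dim_sign_def incidence_def)
    next
      case vertex_edge
      then have "card ?x = 1" by simp
      with vertex_edge(2) have "?x \<noteq> ?y" by auto
      with vertex_edge show ?thesis by (simp add: lhs rhs MN0 incidence_def)
    next
      case edge_vertex
      then have "card ?y = 1" by simp
      with edge_vertex(1) have "?x \<noteq> ?y" by auto
      with edge_vertex show ?thesis by (simp add: lhs rhs MN0 incidence_def)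
    qed
  next
    case False
    then have c: "card ?x = 2" "card ?y = 2" using x y by auto
    have "(M * N) $$ (i, j) = of_nat (card (?x \<inter> ?y))"
      unfolding M_def N_def by (rule incidence_gram_entry[OF G(1) xs ij c])
    with c have rhs': "(J + N + M + M * N) $$ (i, j) = of_nat (card (?x \<inter> ?y)) - of_bool (?x = ?y)"
      unfolding rhs by (simp add: dim_sign_def incidence_def)
    show ?thesis
    proof (cases "?x = ?y")
      case True
      have "of_nat (card (?x \<inter> ?y)) = (2 :: complex)" using True c by simp
      moreover have "?x \<inter> ?y \<noteq> {}" using True x(2) by simp
      ultimately show ?thesis using True unfolding lhs rhs' by simp
    next
      case False
      have "card (?x \<inter> ?y) \<noteq> 2"
        using False c card_subset_eq[OF x(1), of "?x \<inter> ?y"] card_subset_eq[OF y(1), of "?x \<inter> ?y"]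
        by auto
      moreover have "card (?x \<inter> ?y) \<le> 2" using card_mono[OF x(1), of "?x \<inter> ?y"] c by simp
      ultimately have "card (?x \<inter> ?y) = 0 \<or> card (?x \<inter> ?y) = 1" by linarith
      then have "card (?x \<inter> ?y) = of_bool (?x \<inter> ?y \<noteq> {})" using x(1) by auto
      then show ?thesis using False unfolding lhs rhs' by simp
    qed
  qed
qed (simp_all add: connection_laplacian_def M_def N_def incidence_mat_def)

theorem corollary4:
  fixes G :: "'a set set" and xs :: "'a set list"
  assumes "simplicial_complex G" and "one_dimensional G"
    and "distinct xs" and "set xs = G"
  defines "L \<equiv> connection_laplacian xs"
  shows "spectrum_mset (L ^\<^sub>m 2) = spectrum_mset (mat_inv L ^\<^sub>m 2)"
proof -
  let ?n = "length xs" and ?J = "dim_sign_mat xs" and ?N = "incidence_mat xs"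
  let ?M = "transpose_mat ?N"
  define K where "K = ?J + ?N + ?M - ?N * ?M"
  define S where "S = ?N - ?M"
  have decomp: "L = ?J + ?N + ?M + ?M * ?N"
    unfolding L_def by (rule connection_laplacian_decomposition[OF assms(1-4)])
  have carr: "L \<in> carrier_mat ?n ?n" "K \<in> carrier_mat ?n ?n" "S \<in> carrier_mat ?n ?n"
    by (simp_all add: L_def K_def S_def minus_carrier_mat mult_carrier_mat[of _ _ ?n])
  note identities =
    incidence_algebra[OF incidence_carrier(2,4,3) incidence_relations[of xs], folded decomp K_def S_def]
  have "det L \<noteq> 0"
    unfolding L_def by (rule det_connection_laplacian_nonzero[OF assms(1-4)])
  note inv = mat_inv[OF carr(1) this]
  have "mat_inv L = mat_inv L * (L * K)" using inv(1) identities(1) by simp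
  also have "\<dots> = (mat_inv L * L) * K" by (rule assoc_mult_mat[OF inv(1) carr(1,2), symmetric])
  also have "\<dots> = K" using inv(3) carr(2) by simp
  finally have K_inv: "mat_inv L = K" .
  have square: "A ^\<^sub>m 2 = A * A" if "A \<in> carrier_mat ?n ?n" for A :: "complex mat"
    using that by (simp add: numeral_2_eq_2)
  have "char_poly (1\<^sub>m ?n - S * (S * L)) = char_poly (1\<^sub>m ?n - (S * L) * S)"
    by (rule char_poly_one_minus_mult_commute[OF carr(3) mult_carrier_mat[OF carr(3,1)]])
  then show ?thesis using carr identities(2,3) by (simp add: K_inv spectrum_mset_def square)
qed

end
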